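(* Let $p\ge1$ be real and let $D$ and $D'$ be finite persistence diagrams. Then $$W_p(D,D')^p\ \ge\ \min\left(1,\ \frac12\left[W_\infty(D,\emptyset)+\frac{1}{p+1}\right]^{-1}\Lambda_p(D,D')^p\right).$$
   Context: A persistence diagram is an equivalence class of multisets of pairs of real numbers $(b,d)$ with $b\le d$, where $D\sim D\amalg\{(t,t)\}$ for any $t\in\mathbb{R}$, so points on the diagonal may be freely adjoined (as many as necessary). Each diagram has a unique representative $\hat D$ with no points on the diagonal; $|D|=|\hat D|$, and $D$ is finite if $|D|<\infty$. $\emptyset$ is the empty diagram. For a finite diagram $D$, its persistence landscape is $\lambda:\mathbb{N}\times\mathbb{R}\to\mathbb{R}$, $\mathbb{N}=\{1,2,\ldots\}$, where $\lambda_k(t)=\lambda(k,t)$ is the $k$th largest value of $\max(\min(t-b,d-t),0)$ over $(b,d)\in\hat D$ (and $0$ if there are fewer than $k$ points). If $\lambda,\lambda'$ are the landscapes of $D,D'$, the $p$-landscape distance is $\Lambda_p(D,D')=\|\lambda-\lambda'\|_p$, where $\|\lambda-\lambda'\|_p^p=\sum_{k=1}^\infty\int_{\mathbb{R}}|\lambda_k(t)-\lambda'_k(t)|^p\,dt$. A bijection $\varphi:D\to D'$ is a bijection $x_j\mapsto x_j'$, $j=1,\dots,n$, $n=|D|+|D'|$, between representatives of $D$ and $D'$ with diagonal points adjoined; write $x_j=(b_j,d_j)$, $x_j'=(b_j',d_j')$ and $\varepsilon_j=\max(|b_j-b_j'|,|d_j-d_j'|)$. The $p$-Wasserstein distance is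 $W_p(D,D')=\inf_\varphi\big[\sum_j\varepsilon_j^p\big]^{1/p}$ and the bottleneck distance is $W_\infty(D,D')=\inf_\varphi\sup_j\varepsilon_j$, infima over all such bijections. In particular $W_\infty(D,\emptyset)=\frac12\max_{(b,d)\in\hat D}(d-b)$ (and $0$ if $\hat D=\emptyset$). *)

theory Defs
  imports "HOL-Analysis.Analysis" "HOL-Library.Multiset"
begin

type_synonym point = "real \<times> real"

definition pd_multisets :: "point multiset set" where
  "pd_multisets = {M. \<forall>(b, d) \<in># M. b \<le> d}"

definition on_diagonal :: "point multiset \<Rightarrow> bool" where
  "on_diagonal A \<longleftrightarrow> (\<forall>(b, d) \<in># A. b = d)"

(* The equivalence relation generated by M ~ M + {#(t, t)#}: two multisets are related iff they
   agree after diagonal points have been adjoined to both. *)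
definition diag_rel :: "(point multiset \<times> point multiset) set" where
  "diag_rel = {(M, N). M \<in> pd_multisets \<and> N \<in> pd_multisets \<and>
     (\<exists>A B. on_diagonal A \<and> on_diagonal B \<and> M + A = N + B)}"

(* A diagram is the set of its representatives.  Since multisets in HOL-Library are finite, these
   are exactly the finite persistence diagrams. *)
definition finite_diagrams :: "point multiset set set" where
  "finite_diagrams = pd_multisets // diag_rel"

definition empty_diagram :: "point multiset set" where
  "empty_diagram = diag_rel `` {{#}}"

definition reduced :: "point multiset set \<Rightarrow> point multiset" where
  "reduced D = (THE M. M \<in> D \<and> (\<forall>(b, d) \<in># M. b \<noteq> d))"

definition card_diagram :: "point multiset set \<Rightarrow> nat" where
  "card_diagram D = size (reduced D)"

lemma equiv_diag_rel: "equiv pd_multisets diag_rel"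
proof (rule equivI)
  show "diag_rel \<subseteq> pd_multisets \<times> pd_multisets"
    by (auto simp: diag_rel_def)
  show "refl_on pd_multisets diag_rel"
  proof (rule refl_onI)
    fix M assume "M \<in> pd_multisets"
    moreover have "on_diagonal {#}"
      by (simp add: on_diagonal_def)
    ultimately show "(M, M) \<in> diag_rel"
      unfolding diag_rel_def by blast
  qed
  show "sym diag_rel"
    unfolding sym_def diag_rel_def by (clarsimp, metis)
  show "trans diag_rel"
  proof (rule transI)
    fix L M N assume "(L, M) \<in> diag_rel" "(M, N) \<in> diag_rel"
    then obtain A B A' B' where
      *: "L \<in> pd_multisets" "N \<in> pd_multisets" "on_diagonal A" "on_diagonal B" "on_diagonal A'"
        "on_diagonal B'" "L + A = M + B" "M + A' = N + B'"
      by (auto simp: diag_rel_def)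
    have "L + (A + A') = M + A' + B"
      using *(7) by (metis add.assoc add.commute)
    also have "\<dots> = N + (B' + B)"
      using *(8) by (simp add: add.assoc)
    finally have "L + (A + A') = N + (B' + B)" .
    moreover have "on_diagonal (A + A')" "on_diagonal (B' + B)"
      using * by (auto simp: on_diagonal_def)
    ultimately show "(L, N) \<in> diag_rel"
      using *(1,2) unfolding diag_rel_def by blast
  qed
qed

lemma ex1_reduced:
  assumes "D \<in> finite_diagrams"
  shows "\<exists>!M. M \<in> D \<and> (\<forall>(b, d) \<in># M. b \<noteq> d)"
proof -
  let ?f = "filter_mset (\<lambda>(b, d). b \<noteq> d) :: point multiset \<Rightarrow> _"
  obtain M where M: "M \<in> pd_multisets" "D = diag_rel `` {M}"
    using assms by (auto simp: finite_diagrams_def elim: quotientE)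
  have f_diag: "?f A = {#}" if "on_diagonal A" for A
    using that by (auto simp: on_diagonal_def filter_mset_eq_conv)
  have f_rel: "?f M = ?f N" if "(M, N) \<in> diag_rel" for N
  proof -
    from that obtain A B where "on_diagonal A" "on_diagonal B" "M + A = N + B"
      by (auto simp: diag_rel_def)
    then show ?thesis
      by (metis f_diag filter_union_mset add.right_neutral)
  qed
  have "?f M \<in> D"
  proof -
    have "M + {#} = ?f M + filter_mset (\<lambda>x. \<not> (case x of (b, d) \<Rightarrow> b \<noteq> d)) M"
      using multiset_partition[of M "\<lambda>(b, d). b \<noteq> d"] by simp
    moreover have "?f M \<in> pd_multisets"
      using M(1) by (auto simp: pd_multisets_def)
    moreover have "on_diagonal {#}"
      "on_diagonal (filter_mset (\<lambda>x. \<not> (case x of (b, d) \<Rightarrow> b \<noteq> d)) M)"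
      by (auto simp: on_diagonal_def)
    ultimately show ?thesis
      using M unfolding diag_rel_def by blast
  qed
  moreover have "\<forall>(b, d) \<in># ?f M. b \<noteq> d"
    by auto
  moreover have "N = ?f M" if "N \<in> D" "\<forall>(b, d) \<in># N. b \<noteq> d" for N
  proof -
    have "?f N = N"
      using that(2) by (auto simp: filter_mset_eq_conv)
    then show ?thesis
      using f_rel[of N] that(1) M(2) by simp
  qed
  ultimately show ?thesis
    by blast
qed

definition tent :: "real \<Rightarrow> point \<Rightarrow> real" where
  "tent t = (\<lambda>(b, d). max (min (t - b) (d - t)) 0)"

(* The first argument k = 1, 2, ... follows the mathematical indexing; k = 0 is not used. *)
definition landscape :: "point multiset set \<Rightarrow> nat \<Rightarrow> real \<Rightarrow> real" where
  "landscape D k t =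
     (let vs = rev (sorted_list_of_multiset (image_mset (tent t) (reduced D)))
      in if 1 \<le> k \<and> k \<le> length vs then vs ! (k - 1) else 0)"

(* The summation index is shifted so that it starts at k = 1.  All integrands are continuous with
   compact support and all but finitely many vanish, so neither the Lebesgue integral nor the
   series takes a default value. *)
definition landscape_dist :: "real \<Rightarrow> point multiset set \<Rightarrow> point multiset set \<Rightarrow> real" where
  "landscape_dist p D D' =
     (\<Sum>k. \<integral>t. \<bar>landscape D (Suc k) t - landscape D' (Suc k) t\<bar> powr p \<partial>lborel) powr (1 / p)"

(* A bijection of diagrams, given as a pair of enumerations (x j) and (x' j), j = 1, ..., n, of
   representatives of D and D', where x j is sent to x' j.  Values of x and x' outside {1..n} are
   irrelevant. *)
definition diagram_bij ::
  "point multiset set \<Rightarrow> point multiset set \<Rightarrow> (nat \<Rightarrow> point) \<Rightarrow> (nat \<Rightarrow> point) \<Rightarrow> bool" where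
  "diagram_bij D D' x x' \<longleftrightarrow>
     (let J = mset_set {1..card_diagram D + card_diagram D'}
      in image_mset x J \<in> D \<and> image_mset x' J \<in> D')"

definition eps :: "point \<Rightarrow> point \<Rightarrow> real" where
  "eps = (\<lambda>(b, d) (b', d'). max \<bar>b - b'\<bar> \<bar>d - d'\<bar>)"

definition wasserstein :: "real \<Rightarrow> point multiset set \<Rightarrow> point multiset set \<Rightarrow> real" where
  "wasserstein p D D' =
     Inf {(\<Sum>j = 1..card_diagram D + card_diagram D'. eps (x j) (x' j) powr p) powr (1 / p) | x x'.
            diagram_bij D D' x x'}"

(* Inserting 0 only matters when there are no points at all: it makes the empty supremum 0. *)
definition bottleneck :: "point multiset set \<Rightarrow> point multiset set \<Rightarrow> real" where
  "bottleneck D D' =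
     Inf {Max (insert 0 ((\<lambda>j. eps (x j) (x' j)) ` {1..card_diagram D + card_diagram D'})) | x x'.
            diagram_bij D D' x x'}"

end

theory Submission
  imports Defs
begin

text \<open>Fix a bijection \<open>x\<^sub>j \<mapsto> x'\<^sub>j\<close>. For each \<open>t\<close> the landscape values are the tent values at \<open>t\<close> in
  decreasing order, and sorting both families can only decrease the sum of the convex costs
  \<open>\<bar>u - v\<bar>\<^sup>p\<close>. Hence \<open>\<Lambda>\<^sub>p\<^sup>p\<close> is at most the sum over \<open>j\<close> of the integrals of \<open>\<bar>f\<^sub>j - f'\<^sub>j\<bar>\<^sup>p\<close>, where
  \<open>f\<^sub>j\<close> and \<open>f'\<^sub>j\<close> are the tents of \<open>x\<^sub>j\<close> and \<open>x'\<^sub>j\<close>. On \<open>[b\<^sub>j, d\<^sub>j]\<close> the integrand is at most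
  \<open>\<epsilon>\<^sub>j\<^sup>p\<close>, and outside it is dominated by two flanks of length \<open>\<epsilon>\<^sub>j\<close> which contribute
  \<open>\<epsilon>\<^sub>j\<^sup>p\<^sup>+\<^sup>1 / (p + 1)\<close> each. If the sum of the \<open>\<epsilon>\<^sub>j\<^sup>p\<close> is below 1, then \<open>\<epsilon>\<^sub>j\<^sup>p\<^sup>+\<^sup>1 \<le> \<epsilon>\<^sub>j\<^sup>p\<close>, and
  \<open>d\<^sub>j - b\<^sub>j \<le> 2 W\<^sub>\<infinity>(D, \<emptyset>)\<close> gives the claim.\<close>

section \<open>Convex costs and the rearrangement inequality\<close>

text \<open>On positive arguments this is \<open>powr_convex\<close>. If one argument is 0, the
  inequality reduces to \<open>u powr p \<le> u\<close> for \<open>u\<close> in the unit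
  interval.\<close>

lemma convex_on_powr_nonneg:
  assumes "p \<ge> 1"
  shows "convex_on {0..} (\<lambda>x::real. x powr p)"
proof -
  have scale: "(u * x) powr p \<le> u * x powr p" if "0 \<le> u" "u \<le> 1" "0 \<le> x" for u x :: real
  proof -
    have "u powr p \<le> u"
      using that assms powr_mono'[of 1 p u] by (cases "u = 0") auto
    then show ?thesis
      using that by (simp add: powr_mult mult_right_mono)
  qed
  show ?thesis
    unfolding convex_on_def
  proof (intro conjI ballI allI impI)
    fix x y u v :: real
    assume *: "x \<in> {0..}" "y \<in> {0..}" "0 \<le> u" "0 \<le> v" "u + v = 1"
    consider "x = 0" | "y = 0" | "x > 0" "y > 0"
      using * by force
    then show "(u *\<^sub>R x + v *\<^sub>R y) powr p \<le> u * x powr p + v * y powr p"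
    proof cases
      case 3
      then show ?thesis
        using powr_convex[OF assms] * unfolding convex_on_def by auto
    qed (use scale * in auto)
  qed simp
qed

lemma convex_on_abs_powr:
  assumes "p \<ge> 1"
  shows "convex_on UNIV (\<lambda>x::real. \<bar>x\<bar> powr p)"
  unfolding convex_on_def
proof (intro conjI ballI allI impI)
  fix x y u v :: real
  assume *: "0 \<le> u" "0 \<le> v" "u + v = 1"
  have "\<bar>u * x + v * y\<bar> \<le> u * \<bar>x\<bar> + v * \<bar>y\<bar>"
    using * by (metis abs_mult abs_of_nonneg abs_triangle_ineq)
  then have "\<bar>u * x + v * y\<bar> powr p \<le> (u * \<bar>x\<bar> + v * \<bar>y\<bar>) powr p"
    using assms by (intro powr_mono2) auto
  also have "\<dots> \<le> u * \<bar>x\<bar> powr p + v * \<bar>y\<bar> powr p"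
    using convex_on_powr_nonneg[OF assms] * by (auto simp: convex_on_def)
  finally show "\<bar>u *\<^sub>R x + v *\<^sub>R y\<bar> powr p \<le> u * \<bar>x\<bar> powr p + v * \<bar>y\<bar> powr p"
    by simp
qed simp

text \<open>The differences \<open>a - y\<close> and \<open>x - b\<close> lie between
  \<open>a - b\<close> and \<open>x - y\<close> and have the same sum as these, so they are convex
  combinations of them with interchanged weights. This is the exchange step: uncrossing two pairs
  does not raise the cost.\<close>

lemma convex_swap_le:
  fixes c :: "real \<Rightarrow> real"
  assumes "convex_on UNIV c" "a \<le> x" "y \<le> b"
  shows "c (a - y) + c (x - b) \<le> c (a - b) + c (x - y)"
proof (cases "a = x \<and> y = b")
  case False
  define s where "s = (x - y) - (a - b)"
  \<comment> \<open>The relative position of \<open>a - y\<close> on the segment from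
    \<open>a - b\<close> to \<open>x - y\<close>, whose length is \<open>s\<close>.\<close>
  define v where "v = (b - y) / s"
  have s: "s > 0"
    using False assms by (auto simp: s_def)
  have v: "0 \<le> v" "v \<le> 1" "v * s = b - y"
    using s assms by (auto simp: v_def s_def)
  have 1: "(1 - v) *\<^sub>R (a - b) + v *\<^sub>R (x - y) = a - y"
    using v(3) by (simp add: s_def algebra_simps)
  have 2: "v *\<^sub>R (a - b) + (1 - v) *\<^sub>R (x - y) = x - b"
    using v(3) by (simp add: s_def algebra_simps)
  have "c (a - y) \<le> (1 - v) * c (a - b) + v * c (x - y)"
    using convex_onD[OF assms(1) v(1,2), of "a - b" "x - y"] 1 by simp
  moreover have "c (x - b) \<le> v * c (a - b) + (1 - v) * c (x - y)"
    using convex_onD[OF assms(1), of "1 - v" "a - b" "x - y"] v 2 by simp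
  ultimately show ?thesis
    by (simp add: algebra_simps)
qed auto

lemma sum_list_map2_insort_le:
  fixes c :: "real \<Rightarrow> real"
  assumes "convex_on UNIV c" "length xs = length ys" "sorted xs" "sorted ys"
  shows "sum_list (map2 (\<lambda>a b. c (a - b)) (insort a xs) (insort b ys))
           \<le> c (a - b) + sum_list (map2 (\<lambda>a b. c (a - b)) xs ys)"
  using assms(2-)
proof (induction xs ys arbitrary: a b rule: list_induct2)
  case (Cons x xs y ys)
  \<comment> \<open>If \<open>a\<close> and \<open>b\<close> both pass the heads, the pair itself
    moves on. If only \<open>b\<close> passes, \<open>a\<close> is paired with \<open>y\<close> and
    the displaced head \<open>x\<close> takes its place as the element inserted with
    \<open>b\<close>; the third instance is the mirror case. The exchange step pays for the new
    pairing.\<close>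
  note IH = Cons.IH[of a b] Cons.IH[of x b] Cons.IH[of a y]
  have ins: "insort x xs = x # xs" "insort y ys = y # ys"
    using Cons.prems by (simp_all add: insort_is_Cons)
  consider "a \<le> x" "b \<le> y" | "a \<le> x" "y < b" | "x < a" "b \<le> y" | "x < a" "y < b"
    by linarith
  then show ?case
  proof cases
    case 2
    then show ?thesis
      using IH(2) Cons.prems convex_swap_le[OF assms(1), of a x y b] ins by auto
  next
    case 3
    then show ?thesis
      using IH(3) Cons.prems convex_swap_le[OF assms(1), of x a b y] ins by auto
  qed (use IH(1) Cons.prems in auto)
qed simp

text \<open>Since \<open>sort\<close> inserts the elements one by one, the insertion bound is
  applied once per pair.\<close>

lemma sum_list_map2_sort_le:
  fixes c :: "real \<Rightarrow> real"
  assumes "convex_on UNIV c" "length xs = length ys"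
  shows "sum_list (map2 (\<lambda>a b. c (a - b)) (sort xs) (sort ys))
           \<le> sum_list (map2 (\<lambda>a b. c (a - b)) xs ys)"
  using assms(2)
proof (induction xs ys rule: list_induct2)
  case (Cons x xs y ys)
  then show ?case
    using sum_list_map2_insort_le[OF assms(1), of "sort xs" "sort ys" x y] by simp
qed simp

section \<open>Pointwise and integral bounds for tents\<close>

lemma tent_nonneg: "tent t x \<ge> 0"
  by (simp add: tent_def split: prod.split)

lemma tent_diagonal [simp]: "tent t (b, b) = 0"
  by (simp add: tent_def)

lemma eps_nonneg: "eps x y \<ge> 0"
  by (auto simp: eps_def split: prod.split)

lemma half_persistence_le_eps: "(d - b) / 2 \<le> eps (b, d) (t, t)"
proof -
  have "d - b \<le> \<bar>b - t\<bar> + \<bar>d - t\<bar>"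
    by linarith
  moreover have "\<bar>b - t\<bar> \<le> eps (b, d) (t, t)" "\<bar>d - t\<bar> \<le> eps (b, d) (t, t)"
    by (auto simp: eps_def)
  ultimately show ?thesis
    by simp
qed

lemma measurable_tent [measurable]: "(\<lambda>t. tent t x) \<in> borel_measurable borel"
  by (simp add: tent_def split: prod.split)

lemma abs_tent_diff_le: "\<bar>tent t x - tent t y\<bar> \<le> eps x y"
  by (auto simp: tent_def eps_def split: prod.split)

lemma has_bochner_integral_powr_from_0:
  fixes p c :: real
  assumes "p > 0" "c \<ge> 0"
  shows "has_bochner_integral lborel (\<lambda>t. indicat_real {0..c} t * t powr p) (c powr (p + 1) / (p + 1))"
proof -
  have "continuous_on {0..c} (\<lambda>t. t powr p)"
    using assms by (intro continuous_on_powr' continuous_intros) auto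
  then have int: "set_integrable lborel {0..c} (\<lambda>t. t powr p)"
    by (rule borel_integrable_atLeastAtMost')
  have "(LINT t:{0..c}|lborel. t powr p) = c powr (p + 1) / (p + 1)"
    using set_borel_integral_eq_integral(2)[OF int] has_integral_powr_from_0[of p c] assms
    by (simp add: integral_unique)
  then show ?thesis
    using int unfolding set_integrable_def set_lebesgue_integral_def
    by (simp add: has_bochner_integral_iff)
qed

text \<open>Outside \<open>{b..d}\<close> the tent of \<open>(b, d)\<close> vanishes, and the sides
  of the tent of \<open>y\<close> start at most \<open>e\<close> further out. The flanks are written
  as one function of \<open>a + s * t\<close> with explicit \<open>s = 1\<close> and
  \<open>s = -1\<close>, ready for an affine substitution.\<close>

lemma tent_diff_powr_le:
  fixes b d p :: real and y :: point
  defines "e \<equiv> eps (b, d) y"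
  assumes "p > 0"
  shows "\<bar>tent t (b, d) - tent t y\<bar> powr p \<le>
           indicat_real {b..d} t * e powr p
           + indicat_real {0..e} (e - b + 1 * t) * (e - b + 1 * t) powr p
           + indicat_real {0..e} (e + d + (-1) * t) * (e + d + (-1) * t) powr p"
    (is "_ \<le> ?A + ?B + ?C")
proof -
  obtain b' d' where y: "y = (b', d')"
    by fastforce
  have e: "\<bar>b - b'\<bar> \<le> e" "\<bar>d - d'\<bar> \<le> e"
    by (auto simp: e_def y eps_def)
  have nonneg: "?A \<ge> 0" "?B \<ge> 0" "?C \<ge> 0"
    by (auto simp: indicator_def)
  let ?l = "\<bar>tent t (b, d) - tent t y\<bar>"
  consider "t \<in> {b..d}" | "t < b" | "t > d" by force
  then show ?thesis
  proof cases
    case 1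
    have "?l powr p \<le> e powr p"
      using abs_tent_diff_le[of t "(b, d)" y] assms by (intro powr_mono2) auto
    also have "\<dots> = ?A"
      using 1 by simp
    finally show ?thesis
      using nonneg by linarith
  next
    case 2
    then have l: "?l \<le> max (e - b + t) 0"
      using e by (auto simp: tent_def y)
    show ?thesis
    proof (cases "e - b + t \<ge> 0")
      case True
      then have "?l powr p \<le> (e - b + t) powr p"
        using l assms by (intro powr_mono2) auto
      also have "\<dots> = ?B"
        using 2 True by simp
      finally show ?thesis
        using nonneg by linarith
    next
      case False
      then have "?l = 0"
        using l by simp
      then have "?l powr p = 0"
        by simp
      then show ?thesis
        using nonneg by linarith
    qed
  next
    case 3
    then have l: "?l \<le> max (e + d - t) 0"
      using e by (auto simp: tent_def y)
    show ?thesis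
    proof (cases "e + d - t \<ge> 0")
      case True
      then have "?l powr p \<le> (e + d - t) powr p"
        using l assms by (intro powr_mono2) auto
      also have "\<dots> = ?C"
        using 3 True by simp
      finally show ?thesis
        using nonneg by linarith
    next
      case False
      then have "?l = 0"
        using l by simp
      then have "?l powr p = 0"
        by simp
      then show ?thesis
        using nonneg by linarith
    qed
  qed
qed

lemma tent_diff_integral:
  fixes b d p :: real and y :: point
  defines "e \<equiv> eps (b, d) y"
  assumes "p > 0" "b \<le> d"
  shows "integrable lborel (\<lambda>t. \<bar>tent t (b, d) - tent t y\<bar> powr p)" (is "integrable _ ?f")
    and "(\<integral>t. \<bar>tent t (b, d) - tent t y\<bar> powr p \<partial>lborel)
           \<le> (d - b) * e powr p + 2 / (p + 1) * e powr (p + 1)"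
proof -
  have e: "e \<ge> 0"
    by (simp add: e_def eps_nonneg)
  let ?g = "\<lambda>t. indicat_real {0..e} t * t powr p"
  let ?G = "\<lambda>t. indicat_real {b..d} t * e powr p + ?g (e - b + 1 * t) + ?g (e + d + (-1) * t)"
  note g = has_bochner_integral_powr_from_0[OF assms(2) e]
  have g_int: "integrable lborel ?g" "integral\<^sup>L lborel ?g = e powr (p + 1) / (p + 1)"
    using g by (auto simp: has_bochner_integral_iff)
  \<comment> \<open>Translations and reflections preserve the integral, so one computation serves
    both flanks.\<close>
  have *: "has_bochner_integral lborel (\<lambda>t. ?g (a + s * t)) (e powr (p + 1) / (p + 1))"
    if "\<bar>s\<bar> = 1" for a s
    using lborel_integrable_real_affine[OF g_int(1), of s a] lborel_integral_real_affine[of s ?g a]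
      g_int(2) that by (auto simp: has_bochner_integral_iff)
  have "has_bochner_integral lborel (\<lambda>t. indicat_real {b..d} t * e powr p) ((d - b) * e powr p)"
    using assms(3) by (auto simp: has_bochner_integral_iff)
  from has_bochner_integral_add[OF has_bochner_integral_add[OF this *[of 1 "e - b"]] *[of "-1" "e + d"]]
  have G: "has_bochner_integral lborel ?G ((d - b) * e powr p + 2 / (p + 1) * e powr (p + 1))"
    by (simp add: algebra_simps)
  have G_int: "integrable lborel ?G"
    "integral\<^sup>L lborel ?G = (d - b) * e powr p + 2 / (p + 1) * e powr (p + 1)"
    using G by (auto simp: has_bochner_integral_iff)
  have le: "?f t \<le> ?G t" for t
    using tent_diff_powr_le[OF assms(2), of t b d y] by (simp add: e_def)
  show f: "integrable lborel ?f"
  proof (rule Bochner_Integration.integrable_bound[OF G_int(1)])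
    show "AE t in lborel. norm (?f t) \<le> norm (?G t)"
      using le by (intro always_eventually allI order_trans[OF _ abs_ge_self]) simp
  qed measurable
  show "integral\<^sup>L lborel ?f \<le> (d - b) * e powr p + 2 / (p + 1) * e powr (p + 1)"
    unfolding G_int(2)[symmetric] by (intro integral_mono f G_int(1) le)
qed

section \<open>Representatives, bijections and the distance to the empty diagram\<close>

lemma reduced_mem: "D \<in> finite_diagrams \<Longrightarrow> reduced D \<in> D"
  and reduced_off_diagonal: "D \<in> finite_diagrams \<Longrightarrow> (b, d) \<in># reduced D \<Longrightarrow> b \<noteq> d"
  using theI'[OF ex1_reduced, of D] unfolding reduced_def by blast+

lemma mem_diagram_le:
  assumes "D \<in> finite_diagrams" "M \<in> D" "(b, d) \<in># M"
  shows "b \<le> d"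
  using in_quotient_imp_subset[OF equiv_diag_rel, of D] assms
  by (auto simp: finite_diagrams_def pd_multisets_def)

lemma diagram_add_diagonal:
  assumes "D \<in> finite_diagrams" "M \<in> D" "on_diagonal A"
  shows "M + A \<in> D"
proof (rule in_quotient_imp_closed[OF equiv_diag_rel])
  show "D \<in> pd_multisets // diag_rel" "M \<in> D"
    using assms by (auto simp: finite_diagrams_def)
  have "M \<in> pd_multisets" "M + A \<in> pd_multisets"
    using mem_diagram_le[OF assms(1,2)] assms(3) by (auto simp: pd_multisets_def on_diagonal_def)
  moreover have "M + A = (M + A) + {#}" "on_diagonal {#}"
    by (auto simp: on_diagonal_def)
  ultimately show "(M, M + A) \<in> diag_rel"
    unfolding diag_rel_def using assms(3) by blast
qed

text \<open>Equivalent multisets have the same off-diagonal part, because the filter removes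
  everything adjoined on either side; for \<open>reduced D\<close> that part is the whole
  multiset.\<close>

lemma mem_diagramE:
  assumes "D \<in> finite_diagrams" "M \<in> D"
  obtains A where "on_diagonal A" "M = reduced D + A"
proof -
  let ?f = "filter_mset (\<lambda>(b, d). b \<noteq> d) :: point multiset \<Rightarrow> _"
  let ?g = "filter_mset (\<lambda>x. \<not> (case x of (b, d) \<Rightarrow> b \<noteq> d)) :: point multiset \<Rightarrow> _"
  have "(reduced D, M) \<in> diag_rel"
    using in_quotient_imp_in_rel[OF equiv_diag_rel, of D "reduced D" M] assms reduced_mem
    by (auto simp: finite_diagrams_def)
  then obtain A B where AB: "on_diagonal A" "on_diagonal B" "reduced D + A = M + B"
    by (auto simp: diag_rel_def)
  have f_diag: "?f C = {#}" if "on_diagonal C" for C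
    using that by (auto simp: on_diagonal_def filter_mset_eq_conv)
  have "?f (reduced D) = ?f M"
    using AB by (metis f_diag filter_union_mset add.right_neutral)
  moreover have "?f (reduced D) = reduced D"
    using reduced_off_diagonal[OF assms(1)] by (auto simp: filter_mset_eq_conv)
  moreover have "M = ?f M + ?g M"
    by (rule multiset_partition)
  moreover have "on_diagonal (?g M)"
    by (auto simp: on_diagonal_def)
  ultimately show ?thesis
    using that by metis
qed

lemma empty_diagram_mem: "{#} \<in> empty_diagram"
  by (auto simp: empty_diagram_def diag_rel_def pd_multisets_def on_diagonal_def
      intro!: exI[of _ "{#}"])

lemma empty_diagram_finite: "empty_diagram \<in> finite_diagrams"
  by (auto simp: empty_diagram_def finite_diagrams_def pd_multisets_def intro: quotientI)

lemma reduced_empty_diagram [simp]: "reduced empty_diagram = {#}"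
  using mem_diagramE[OF empty_diagram_finite empty_diagram_mem] by (metis empty_eq_union)

lemma ex_image_mset_enumeration:
  obtains x where "image_mset x (mset_set {1..size M}) = M"
proof -
  obtain xs where xs: "mset xs = M"
    using ex_mset by blast
  have "image_mset (\<lambda>j. xs ! (j - 1)) (mset_set {1..length xs}) = mset (map (\<lambda>j. xs ! (j - 1)) [1..<Suc (length xs)])"
    by (metis atLeastLessThanSuc_atLeastAtMost mset_map mset_upt)
  also have "map (\<lambda>j. xs ! (j - 1)) [1..<Suc (length xs)] = xs"
    by (rule nth_equalityI) (auto simp del: upt_Suc)
  finally show ?thesis
    using that xs by (metis size_mset)
qed

text \<open>Padding each reduced multiset with copies of the origin brings both to the common size.
  This makes the sets under the infima nonempty, so that lower bounds pass to
  \<open>Inf\<close>.\<close>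

lemma ex_diagram_bij:
  assumes "D \<in> finite_diagrams" "D' \<in> finite_diagrams"
  obtains x x' where "diagram_bij D D' x x'"
proof -
  let ?o = "(0, 0) :: point"
  have diag: "on_diagonal (replicate_mset k ?o)" for k
    by (auto simp: on_diagonal_def in_replicate_mset)
  define M where "M = reduced D + replicate_mset (card_diagram D') ?o"
  define M' where "M' = reduced D' + replicate_mset (card_diagram D) ?o"
  have "M \<in> D" "M' \<in> D'"
    unfolding M_def M'_def by (intro diagram_add_diagonal assms reduced_mem diag)+
  moreover have "size M = card_diagram D + card_diagram D'" "size M' = card_diagram D + card_diagram D'"
    by (auto simp: M_def M'_def card_diagram_def)
  ultimately show ?thesis
    using that ex_image_mset_enumeration[of M] ex_image_mset_enumeration[of M']
    unfolding diagram_bij_def Let_def by metis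
qed

text \<open>Every representative of the empty diagram is diagonal, so each bijection sends
  \<open>(b, d)\<close> to a diagonal point, at sup distance at least half the persistence.\<close>

lemma bottleneck_empty_ge:
  assumes "D \<in> finite_diagrams"
  shows "bottleneck D empty_diagram \<ge> 0"
    and "(b, d) \<in># reduced D \<Longrightarrow> (d - b) / 2 \<le> bottleneck D empty_diagram"
proof -
  let ?J = "{1..card_diagram D + card_diagram empty_diagram}"
  let ?S = "{Max (insert 0 ((\<lambda>j. eps (x j) (x' j)) ` ?J)) | x x'. diagram_bij D empty_diagram x x'}"
  have ne: "?S \<noteq> {}"
    using ex_diagram_bij[OF assms empty_diagram_finite] by blast
  show "bottleneck D empty_diagram \<ge> 0"
    unfolding bottleneck_def by (rule cInf_greatest[OF ne]) auto
  assume bd: "(b, d) \<in># reduced D"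
  show "(d - b) / 2 \<le> bottleneck D empty_diagram"
    unfolding bottleneck_def
  proof (rule cInf_greatest[OF ne])
    fix m assume "m \<in> ?S"
    then obtain x x' where m: "m = Max (insert 0 ((\<lambda>j. eps (x j) (x' j)) ` ?J))"
      and "image_mset x (mset_set ?J) \<in> D" "image_mset x' (mset_set ?J) \<in> empty_diagram"
      by (auto simp: diagram_bij_def Let_def)
    then obtain A B where A: "image_mset x (mset_set ?J) = reduced D + A"
      and B: "on_diagonal B" "image_mset x' (mset_set ?J) = B"
      using mem_diagramE[OF assms] mem_diagramE[OF empty_diagram_finite] by (metis add_0 reduced_empty_diagram)
    have "(b, d) \<in># image_mset x (mset_set ?J)"
      using bd A by simp
    then obtain j where j: "j \<in> ?J" "x j = (b, d)"
      by auto
    have "x' j \<in># B"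
      using B(2) j(1) by auto
    then have "fst (x' j) = snd (x' j)"
      using B(1) by (auto simp: on_diagonal_def)
    then have "(d - b) / 2 \<le> eps (x j) (x' j)"
      using half_persistence_le_eps[of d b "fst (x' j)"] j(2) by (metis prod.collapse)
    also have "\<dots> \<le> m"
      unfolding m using j(1) by (intro Max_ge) auto
    finally show "(d - b) / 2 \<le> m" .
  qed
qed

text \<open>Extends the bound to arbitrary representatives: adjoined points have persistence
  0.\<close>

lemma persistence_le_bottleneck:
  assumes "D \<in> finite_diagrams" "M \<in> D" "(b, d) \<in># M"
  shows "d - b \<le> 2 * bottleneck D empty_diagram"
proof -
  obtain A where "on_diagonal A" "M = reduced D + A"
    using mem_diagramE[OF assms(1,2)] .
  then consider "(b, d) \<in># reduced D" | "b = d"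
    using assms(3) by (auto simp: on_diagonal_def)
  then show ?thesis
    using bottleneck_empty_ge[OF assms(1)] by cases force+
qed

section \<open>Landscapes compared along a bijection\<close>

text \<open>Adjoined diagonal points have tent value 0, and tents are nonnegative, so they only
  append zeros to the decreasing list, which agrees with the default value of
  \<open>landscape\<close>.\<close>

lemma landscape_eq_representative:
  assumes "D \<in> finite_diagrams" "M \<in> D"
  defines "vs \<equiv> \<lambda>t. rev (sorted_list_of_multiset (image_mset (tent t) M))"
  shows "landscape D (Suc k) t = (if k < size M then vs t ! k else 0)"
proof -
  obtain A where A: "on_diagonal A" "M = reduced D + A"
    using mem_diagramE[OF assms(1,2)] .
  let ?w = "sorted_list_of_multiset (image_mset (tent t) (reduced D))"
  have "image_mset (tent t) A = replicate_mset (size A) 0"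
    using A(1) by (induction A) (auto simp: on_diagonal_def)
  then have "image_mset (tent t) M = mset (replicate (size A) 0 @ ?w)"
    by (simp add: A(2) add.commute)
  then have "sorted_list_of_multiset (image_mset (tent t) M) = sort (replicate (size A) 0 @ ?w)"
    by (metis sorted_list_of_multiset_mset)
  also have "\<dots> = replicate (size A) 0 @ ?w"
    by (subst sort_append_replicate_left) (auto simp: tent_nonneg sorted_sort_id)
  finally have vs: "vs t = rev ?w @ replicate (size A) 0"
    by (simp add: vs_def)
  have "length ?w = size (reduced D)"
    by (metis size_mset mset_sorted_list_of_multiset size_image_mset)
  then show ?thesis
    by (auto simp: landscape_def vs A(2) nth_append Suc_le_eq)
qed

lemma landscape_diff_sum_le:
  assumes "D \<in> finite_diagrams" "D' \<in> finite_diagrams" "p \<ge> 1"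
    and "image_mset x (mset_set {1..n}) \<in> D" "image_mset x' (mset_set {1..n}) \<in> D'"
  shows "(\<Sum>k<n. \<bar>landscape D (Suc k) t - landscape D' (Suc k) t\<bar> powr p)
           \<le> (\<Sum>j = 1..n. \<bar>tent t (x j) - tent t (x' j)\<bar> powr p)"
proof -
  let ?c = "\<lambda>s::real. \<bar>s\<bar> powr p"
  let ?us = "\<lambda>x. map (\<lambda>j. tent t (x j)) [1..<Suc n]"
  have ls: "landscape E (Suc k) t = sort (?us y) ! (n - Suc k)"
    \<comment> \<open>\<open>sort\<close> is increasing, so the value of rank \<open>Suc k\<close>
      from the top has index \<open>n - Suc k\<close>; the sum over \<open>k\<close> is reversed
      below.\<close>
    if "k < n" "E \<in> finite_diagrams" "image_mset y (mset_set {1..n}) \<in> E" for E y k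
  proof -
    have "image_mset (tent t) (image_mset y (mset_set {1..n})) = mset (?us y)"
      by (simp add: image_mset.compositionality comp_def atLeastLessThanSuc_atLeastAtMost del: upt_Suc)
    then have "sorted_list_of_multiset (image_mset (tent t) (image_mset y (mset_set {1..n}))) = sort (?us y)"
      by (simp only: sorted_list_of_multiset_mset)
    then show ?thesis
      using landscape_eq_representative[OF that(2,3), of k t] that(1)
      by (simp only: size_image_mset size_mset_set card_atLeastAtMost) (simp add: rev_nth del: upt_Suc)
  qed
  have "(\<Sum>k<n. ?c (landscape D (Suc k) t - landscape D' (Suc k) t))
      = (\<Sum>k<n. ?c (sort (?us x) ! (n - Suc k) - sort (?us x') ! (n - Suc k)))"
    by (intro sum.cong refl) (simp only: ls[OF _ assms(1,4)] ls[OF _ assms(2,5)] lessThan_iff)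
  also have "\<dots> = (\<Sum>k<n. ?c (sort (?us x) ! k - sort (?us x') ! k))"
    by (rule sum.nat_diff_reindex)
  also have "\<dots> = sum_list (map2 (\<lambda>a b. ?c (a - b)) (sort (?us x)) (sort (?us x')))"
    by (simp add: sum_list_sum_nth atLeast0LessThan del: upt_Suc)
  also have "\<dots> \<le> sum_list (map2 (\<lambda>a b. ?c (a - b)) (?us x) (?us x'))"
    by (rule sum_list_map2_sort_le[OF convex_on_abs_powr[OF assms(3)]]) simp
  also have "map2 (\<lambda>a b. ?c (a - b)) (?us x) (?us x') = map (\<lambda>j. ?c (tent t (x j) - tent t (x' j))) [1..<Suc n]"
    by (simp add: map2_map_map del: upt_Suc)
  also have "sum_list \<dots> = (\<Sum>j = 1..n. ?c (tent t (x j) - tent t (x' j)))"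
    by (simp only: sum_list_distinct_conv_sum_set distinct_upt set_upt atLeastLessThanSuc_atLeastAtMost)
  finally show ?thesis .
qed

lemma landscape_dist_powr_le:
  assumes "D \<in> finite_diagrams" "D' \<in> finite_diagrams" "p \<ge> 1" "diagram_bij D D' x x'"
  defines "n \<equiv> card_diagram D + card_diagram D'"
  shows "landscape_dist p D D' powr p
    \<le> (\<Sum>j = 1..n. (snd (x j) - fst (x j)) * eps (x j) (x' j) powr p
                      + 2 / (p + 1) * eps (x j) (x' j) powr (p + 1))"
proof -
  have rep: "image_mset x (mset_set {1..n}) \<in> D" "image_mset x' (mset_set {1..n}) \<in> D'"
    using assms(4) by (auto simp: diagram_bij_def n_def Let_def)
  let ?g = "\<lambda>k t. \<bar>landscape D (Suc k) t - landscape D' (Suc k) t\<bar> powr p"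
  let ?h = "\<lambda>j t. \<bar>tent t (x j) - tent t (x' j)\<bar> powr p"
  \<comment> \<open>A non-integrable summand would have integral 0, so measurability of the landscapes
    need not be established.\<close>
  define K where "K = {k \<in> {..<n}. integrable lborel (?g k)}"
  have g_0: "?g k t = 0" if "k \<ge> n" for k t
    using landscape_eq_representative[OF assms(1) rep(1)] landscape_eq_representative[OF assms(2) rep(2)] that
    by simp
  have h: "integrable lborel (?h j)"
    "integral\<^sup>L lborel (?h j) \<le> (snd (x j) - fst (x j)) * eps (x j) (x' j) powr p
                      + 2 / (p + 1) * eps (x j) (x' j) powr (p + 1)"
    if "j \<in> {1..n}" for j
  proof -
    have "x j \<in># image_mset x (mset_set {1..n})"
      using that by auto
    then have "fst (x j) \<le> snd (x j)"
      using mem_diagram_le[OF assms(1) rep(1), of "fst (x j)" "snd (x j)"] by simp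
    then show "integrable lborel (?h j)"
      "integral\<^sup>L lborel (?h j) \<le> (snd (x j) - fst (x j)) * eps (x j) (x' j) powr p
                      + 2 / (p + 1) * eps (x j) (x' j) powr (p + 1)"
      using tent_diff_integral[of p "fst (x j)" "snd (x j)" "x' j"] assms(3) by simp_all
  qed
  have "(\<Sum>k. integral\<^sup>L lborel (?g k)) = (\<Sum>k<n. integral\<^sup>L lborel (?g k))"
    by (rule suminf_finite) (auto simp: g_0)
  also have "\<dots> = (\<Sum>k\<in>K. integral\<^sup>L lborel (?g k))"
    by (rule sum.mono_neutral_right) (auto simp: K_def not_integrable_integral_eq)
  also have "\<dots> = (\<integral>t. (\<Sum>k\<in>K. ?g k t) \<partial>lborel)"
    by (rule Bochner_Integration.integral_sum[symmetric]) (simp add: K_def)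
  also have "\<dots> \<le> (\<integral>t. (\<Sum>j = 1..n. ?h j t) \<partial>lborel)"
  proof (intro integral_mono Bochner_Integration.integrable_sum)
    fix t
    have "(\<Sum>k\<in>K. ?g k t) \<le> (\<Sum>k<n. ?g k t)"
      by (rule sum_mono2) (auto simp: K_def)
    also have "\<dots> \<le> (\<Sum>j = 1..n. ?h j t)"
      by (rule landscape_diff_sum_le[OF assms(1-3) rep])
    finally show "(\<Sum>k\<in>K. ?g k t) \<le> (\<Sum>j = 1..n. ?h j t)" .
  qed (auto simp: K_def h)
  also have "\<dots> = (\<Sum>j = 1..n. integral\<^sup>L lborel (?h j))"
    by (rule Bochner_Integration.integral_sum) (rule h)
  also have "\<dots> \<le> (\<Sum>j = 1..n. (snd (x j) - fst (x j)) * eps (x j) (x' j) powr p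
                      + 2 / (p + 1) * eps (x j) (x' j) powr (p + 1))"
    by (intro sum_mono h)
  finally have le: "(\<Sum>k. integral\<^sup>L lborel (?g k)) \<le> \<dots>" .
  \<comment> \<open>Summability yields a nonnegative series, for which raising the
    \<open>p\<close>-th root to the power \<open>p\<close> gives the series back.\<close>
  have "summable (\<lambda>k. integral\<^sup>L lborel (?g k))"
    by (rule summable_finite[of "{..<n}"]) (auto simp: g_0)
  then have "(\<Sum>k. integral\<^sup>L lborel (?g k)) \<ge> 0"
    by (rule suminf_nonneg) (rule Bochner_Integration.integral_nonneg, simp)
  then show ?thesis
    using le assms(3) by (simp add: landscape_dist_def powr_powr)
qed

theorem corollary5p4:
  fixes p :: real and D D' :: "point multiset set"
  assumes "p \<ge> 1"
    and "D \<in> finite_diagrams" and "D' \<in> finite_diagrams"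
  shows "wasserstein p D D' powr p
    \<ge> min 1 (1 / 2 * inverse (bottleneck D empty_diagram + 1 / (p + 1))
              * landscape_dist p D D' powr p)"
proof -
  let ?n = "card_diagram D + card_diagram D'"
  \<comment> \<open>Twice \<open>c\<close> collects the persistence bound and the coefficient
    \<open>2 / (p + 1)\<close> of the two flanks.\<close>
  define c where "c = bottleneck D empty_diagram + 1 / (p + 1)"
  have c: "c > 0"
    using bottleneck_empty_ge(1)[OF assms(2)] assms(1) by (simp add: c_def add_nonneg_pos)
  define m where "m = min 1 (1 / 2 * inverse c * landscape_dist p D D' powr p)"
  have m: "m \<ge> 0"
    using c by (simp add: m_def)
  have le: "m \<le> (\<Sum>j = 1..?n. eps (x j) (x' j) powr p)" (is "_ \<le> ?S")
    if bij: "diagram_bij D D' x x'" for x x'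
  proof (cases "?S \<ge> 1")
    case False
    have rep: "image_mset x (mset_set {1..?n}) \<in> D"
      using bij by (auto simp: diagram_bij_def Let_def)
    have "(snd (x j) - fst (x j)) * eps (x j) (x' j) powr p + 2 / (p + 1) * eps (x j) (x' j) powr (p + 1)
            \<le> 2 * c * eps (x j) (x' j) powr p" if j: "j \<in> {1..?n}" for j
    proof -
      let ?e = "eps (x j) (x' j)"
      have "?e powr p \<le> ?S"
        using j by (intro member_le_sum) auto
      then have "?e powr p < 1"
        using False by simp
      then have "?e \<le> 1"
        using ge_one_powr_ge_zero[of ?e p] assms(1) by fastforce
      then have "?e powr (p + 1) \<le> ?e powr p"
        by (intro powr_mono') (auto simp: eps_nonneg)
      then have "2 / (p + 1) * ?e powr (p + 1) \<le> 2 / (p + 1) * ?e powr p"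
        using assms(1) by (intro mult_left_mono) auto
      moreover have "x j \<in># image_mset x (mset_set {1..?n})"
        using j by auto
      then have "snd (x j) - fst (x j) \<le> 2 * bottleneck D empty_diagram"
        using persistence_le_bottleneck[OF assms(2) rep, of "fst (x j)" "snd (x j)"] by simp
      then have "(snd (x j) - fst (x j)) * ?e powr p \<le> 2 * bottleneck D empty_diagram * ?e powr p"
        by (intro mult_right_mono) auto
      ultimately show ?thesis
        by (simp add: c_def algebra_simps)
    qed
    then have "landscape_dist p D D' powr p \<le> 2 * c * ?S"
      using landscape_dist_powr_le[OF assms(2,3,1) bij]
      by (force simp: sum_distrib_left intro: order_trans sum_mono)
    then have "1 / 2 * inverse c * landscape_dist p D D' powr p \<le> ?S"
      using c by (simp add: field_simps)
    then show ?thesis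
      by (simp add: m_def)
  qed (simp add: m_def)
  \<comment> \<open>The infimum is taken over \<open>p\<close>-th roots, so the bound on each sum
    passes to it in root form and is then raised to the power \<open>p\<close>.\<close>
  have "m powr (1 / p) \<le> wasserstein p D D'"
    unfolding wasserstein_def
  proof (rule cInf_greatest)
    show "{(\<Sum>j = 1..?n. eps (x j) (x' j) powr p) powr (1 / p) | x x'. diagram_bij D D' x x'} \<noteq> {}"
      using ex_diagram_bij[OF assms(2,3)] by blast
  qed (use le m assms(1) in \<open>auto intro!: powr_mono2\<close>)
  then have "(m powr (1 / p)) powr p \<le> wasserstein p D D' powr p"
    using assms(1) by (intro powr_mono2) auto
  then show ?thesis
    using m assms(1) by (simp add: powr_powr m_def c_def)
qed

end
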